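(* Let $X$ be an initial universe and $E$ a set of parameters. For type-1 soft sets $(F,A),(G,B)\in S(X,E)$ put $$d_m((F,A),(G,B))=|A\cup B|-|A\cap B|+\sum_{\alpha\in A\cup B}\ \sum_{x\in X}|F(\alpha)(x)-G(\alpha)(x)|,$$ where $F(\alpha)(x)=1$ if $x\in F(\alpha)$ and $F(\alpha)(x)=0$ otherwise, and $G(\alpha)(x)=1$ if $x\in G(\alpha)$ and $G(\alpha)(x)=0$ otherwise. Then $d_m$ is a metric on $S(X,E)$.
   Context: A type-1 soft set over $(X,E)$ is a pair $(F,A)$ with $A\subseteq E$ and $F:A\to\mathscr{P}(X)$ a mapping into the power set of $X$; $S(X,E)$ is the set of all of them. Two soft sets $(F,A)$ and $(G,B)$ are equal iff $A=B$ and $F(\alpha)=G(\alpha)$ for all $\alpha\in A$. $|A\cup B|$ and $|A\cap B|$ denote cardinalities. For $\alpha\notin A$ one has $F(\alpha)(x)=0$ for all $x$ (the "otherwise" case), and likewise for $G$ and $\alpha\notin B$. A mapping $d:S(X,E)\times S(X,E)\to\mathbb{R}^{+}$ (the nonnegative reals) is a metric if for all $(F,A),(G,B),(H,C)\in S(X,E)$: (M1) $d((F,A),(G,B))\ge 0$; (M2) $d((F,A),(G,B))=d((G,B),(F,A))$; (M3) $d((F,A),(G,B))+d((G,B),(H,C))\ge d((F,A),(H,C))$; (M4) $(F,A)=(G,B)$ implies $d((F,A),(G,B))=0$; (M5) $d((F,A),(G,B))=0$ implies $(F,A)=(G,B)$.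
   Formalization: The universe X and the parameter set E are assumed finite; otherwise |A∪B|−|A∩B| may be ∞−∞ or the double sum may diverge, so d_m would not be a real-valued function on S(X,E). *)

theory Defs
  imports Complex_Main "HOL-Library.FuncSet" "HOL-Analysis.Abstract_Metric_Spaces"
begin

text \<open>
  A soft set is a pair \<open>(F, A)\<close> of a mapping and its domain. Since HOL functions are total,
  \<open>F\<close> is required to be extensional (\<open>F \<alpha> = undefined\<close> for \<open>\<alpha> \<notin> A\<close>), so that each mapping
  \<open>A \<rightarrow> Pow X\<close> has exactly one representative; see \<open>soft_set_eq_iff\<close> below.
\<close>

type_synonym ('e, 'x) soft_set = "('e \<Rightarrow> 'x set) \<times> 'e set"

definition soft_sets :: "'x set \<Rightarrow> 'e set \<Rightarrow> ('e, 'x) soft_set set" where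
  "soft_sets X E = {(F, A). A \<subseteq> E \<and> F \<in> A \<rightarrow>\<^sub>E Pow X}"

lemma soft_set_eq_iff:
  assumes "(F, A) \<in> soft_sets X E" and "(G, B) \<in> soft_sets X E"
  shows "(F, A) = (G, B) \<longleftrightarrow> A = B \<and> (\<forall>\<alpha>\<in>A. F \<alpha> = G \<alpha>)"
proof
  assume *: "A = B \<and> (\<forall>\<alpha>\<in>A. F \<alpha> = G \<alpha>)"
  have "F \<in> A \<rightarrow>\<^sub>E Pow X" "G \<in> B \<rightarrow>\<^sub>E Pow X"
    using assms by (simp_all add: soft_sets_def)
  with * have "F = G" by (metis PiE_ext)
  with * show "(F, A) = (G, B)" by simp
qed simp

text \<open>
  The value \<open>F(\<alpha>)(x)\<close>. The condition \<open>\<alpha> \<in> A\<close> is needed because the value of \<open>F\<close> outside \<open>A\<close>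
  is an arbitrary set, whereas \<open>F(\<alpha>)(x) = 0\<close> is intended there.
\<close>

definition soft_val :: "('e, 'x) soft_set \<Rightarrow> 'e \<Rightarrow> 'x \<Rightarrow> real" where
  "soft_val = (\<lambda>(F, A) \<alpha> x. if \<alpha> \<in> A \<and> x \<in> F \<alpha> then 1 else 0)"

text \<open>The subtraction of cardinalities is taken in the reals, not truncated.\<close>

definition d_m :: "'x set \<Rightarrow> ('e, 'x) soft_set \<Rightarrow> ('e, 'x) soft_set \<Rightarrow> real" where
  "d_m X = (\<lambda>(F, A) (G, B).
     real (card (A \<union> B)) - real (card (A \<inter> B))
     + (\<Sum>\<alpha>\<in>A \<union> B. \<Sum>x\<in>X. \<bar>soft_val (F, A) \<alpha> x - soft_val (G, B) \<alpha> x\<bar>))"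

text \<open>
  A metric on the carrier \<open>S\<close> only. The library locale \<open>Metric_space\<close> in addition demands nonnegativity and
  symmetry on the whole type; the two notions agree up to the values of \<open>d\<close> outside \<open>S\<close>,
  which is the content of \<open>metric_on_iff_Metric_space\<close>.
\<close>

definition metric_on :: "'a set \<Rightarrow> ('a \<Rightarrow> 'a \<Rightarrow> real) \<Rightarrow> bool" where
  "metric_on S d \<longleftrightarrow>
     (\<forall>p\<in>S. \<forall>q\<in>S. d p q \<ge> 0) \<and>
     (\<forall>p\<in>S. \<forall>q\<in>S. d p q = d q p) \<and>
     (\<forall>p\<in>S. \<forall>q\<in>S. \<forall>r\<in>S. d p q + d q r \<ge> d p r) \<and>
     (\<forall>p\<in>S. \<forall>q\<in>S. p = q \<longrightarrow> d p q = 0) \<and>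
     (\<forall>p\<in>S. \<forall>q\<in>S. d p q = 0 \<longrightarrow> p = q)"

lemma metric_on_iff_Metric_space:
  "metric_on S d \<longleftrightarrow> Metric_space S (\<lambda>p q. if p \<in> S \<and> q \<in> S then d p q else 0)"
proof
  assume "metric_on S d"
  then show "Metric_space S (\<lambda>p q. if p \<in> S \<and> q \<in> S then d p q else 0)"
    unfolding metric_on_def Metric_space_def by (simp, blast)
next
  assume "Metric_space S (\<lambda>p q. if p \<in> S \<and> q \<in> S then d p q else 0)"
  then interpret Metric_space S "\<lambda>p q. if p \<in> S \<and> q \<in> S then d p q else 0" .
  have "d p q \<ge> 0" if "p \<in> S" "q \<in> S" for p q using nonneg[of p q] that by simp
  moreover have "d p q = d q p" if "p \<in> S" "q \<in> S" for p q using commute[of p q] that by simp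
  moreover have "d p r \<le> d p q + d q r" if "p \<in> S" "q \<in> S" "r \<in> S" for p q r
    using triangle[of p q r] that by simp
  moreover have "d p q = 0 \<longleftrightarrow> p = q" if "p \<in> S" "q \<in> S" for p q using zero[of p q] that by simp
  ultimately show "metric_on S d" unfolding metric_on_def by blast
qed

end

(* Each term of d_m can be extended to a sum over all of E, where the cardinality part
   counts the symmetric difference of A and B. So d_m is the l1 distance between the vectors
   of indicator values of A and of the relation {(alpha, x). x : F alpha}, and these two
   indicators determine the soft set (F, A). *)
theory Submission
  imports Defs
begin

text \<open>Both cardinalities are sums of indicators over the finite set \<open>E\<close>, and
  pointwise the indicator of the union minus that of the intersection is 1 exactly when one of the
  two memberships holds without the other.\<close>

lemma card_Un_minus_card_Int_eq_sum:
  assumes "finite E" "A \<subseteq> E" "B \<subseteq> E"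
  shows "real (card (A \<union> B)) - real (card (A \<inter> B))
    = (\<Sum>\<alpha>\<in>E. \<bar>of_bool (\<alpha> \<in> A) - of_bool (\<alpha> \<in> B)\<bar>)"
proof -
  have card: "real (card C) = (\<Sum>\<alpha>\<in>E. of_bool (\<alpha> \<in> C))" if "C \<subseteq> E" for C
    using assms(1) that by (simp add: sum_of_bool_eq Int_absorb1)
  have "real (card (A \<union> B)) - real (card (A \<inter> B))
    = (\<Sum>\<alpha>\<in>E. of_bool (\<alpha> \<in> A \<union> B) - of_bool (\<alpha> \<in> A \<inter> B))"
    using assms by (subst (1 2) card) (auto simp: sum_subtractf)
  also have "\<dots> = (\<Sum>\<alpha>\<in>E. \<bar>of_bool (\<alpha> \<in> A) - of_bool (\<alpha> \<in> B)\<bar>)"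
    by (rule sum.cong) auto
  finally show ?thesis .
qed

text \<open>The index set \<open>A \<union> B\<close> varies with the pair; the fixed index set
  \<open>E\<close> lets distances between different pairs be compared term by term.\<close>

lemma d_m_eq_sum:
  assumes "finite E" "p \<in> soft_sets X E" "q \<in> soft_sets X E"
  shows "d_m X p q = (\<Sum>\<alpha>\<in>E. \<bar>of_bool (\<alpha> \<in> snd p) - of_bool (\<alpha> \<in> snd q)\<bar>)
    + (\<Sum>\<alpha>\<in>E. \<Sum>x\<in>X. \<bar>soft_val p \<alpha> x - soft_val q \<alpha> x\<bar>)"
proof -
  obtain F A G B where pq: "p = (F, A)" "q = (G, B)"
    by (metis surj_pair)
  with assms have sub: "A \<subseteq> E" "B \<subseteq> E"
    by (auto simp: soft_sets_def)
  \<comment> \<open>A parameter outside \<open>A \<union> B\<close> contributes nothing, since both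
    values are 0 there by default.\<close>
  have "(\<Sum>\<alpha>\<in>A \<union> B. \<Sum>x\<in>X. \<bar>soft_val (F, A) \<alpha> x - soft_val (G, B) \<alpha> x\<bar>)
    = (\<Sum>\<alpha>\<in>E. \<Sum>x\<in>X. \<bar>soft_val (F, A) \<alpha> x - soft_val (G, B) \<alpha> x\<bar>)"
    using assms(1) sub by (intro sum.mono_neutral_left) (auto simp: soft_val_def)
  then show ?thesis
    using card_Un_minus_card_Int_eq_sum[OF assms(1) sub] by (simp add: pq d_m_def)
qed

text \<open>Testing points of \<open>X\<close> suffices because each \<open>F \<alpha>\<close> with
  \<open>\<alpha> \<in> A\<close> is a subset of \<open>X\<close>. Equality of the domains is a
  separate premise: \<open>soft_val\<close> cannot tell an empty value from an absent
  parameter.\<close>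

lemma soft_set_eqI:
  assumes "p \<in> soft_sets X E" "q \<in> soft_sets X E" "snd p = snd q"
    and val: "\<And>\<alpha> x. \<alpha> \<in> E \<Longrightarrow> x \<in> X \<Longrightarrow> soft_val p \<alpha> x = soft_val q \<alpha> x"
  shows "p = q"
proof -
  obtain F G A where pq: "p = (F, A)" "q = (G, A)"
    by (metis assms(3) prod.collapse)
  have "F \<alpha> = G \<alpha>" if "\<alpha> \<in> A" for \<alpha>
  proof -
    have "\<alpha> \<in> E" "F \<alpha> \<subseteq> X" "G \<alpha> \<subseteq> X"
      using assms(1,2) that by (auto simp: pq soft_sets_def)
    moreover have "x \<in> F \<alpha> \<longleftrightarrow> x \<in> G \<alpha>" if "x \<in> X" for x
      using val[OF \<open>\<alpha> \<in> E\<close> that] \<open>\<alpha> \<in> A\<close> by (simp add: pq soft_val_def split: if_splits)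
    ultimately show ?thesis by blast
  qed
  then show ?thesis
    using assms(1,2) soft_set_eq_iff unfolding pq by blast
qed

theorem theorem3p6:
  fixes X :: "'x set" and E :: "'e set"
  assumes "finite X" and "finite E"
  shows "metric_on (soft_sets X E) (d_m X)"
proof -
  note eq = d_m_eq_sum[OF assms(2), where X = X]
  have "d_m X p q \<ge> 0" if "p \<in> soft_sets X E" "q \<in> soft_sets X E" for p q
    using that by (simp add: eq sum_nonneg)
  moreover have "d_m X p q = d_m X q p"
    if "p \<in> soft_sets X E" "q \<in> soft_sets X E" for p q
    using that by (simp add: eq abs_minus_commute)
  moreover have "d_m X p r \<le> d_m X p q + d_m X q r"
    if "p \<in> soft_sets X E" "q \<in> soft_sets X E" "r \<in> soft_sets X E" for p q r
  proof -
    \<comment> \<open>Once the two sums on the right are merged, this is the triangle inequality for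
      real numbers in each term; the double sum below is treated alike.\<close>
    have "(\<Sum>\<alpha>\<in>E. \<bar>of_bool (\<alpha> \<in> snd p) - of_bool (\<alpha> \<in> snd r)\<bar> :: real)
      \<le> (\<Sum>\<alpha>\<in>E. \<bar>of_bool (\<alpha> \<in> snd p) - of_bool (\<alpha> \<in> snd q)\<bar>)
        + (\<Sum>\<alpha>\<in>E. \<bar>of_bool (\<alpha> \<in> snd q) - of_bool (\<alpha> \<in> snd r)\<bar>)"
      unfolding sum.distrib[symmetric] by (intro sum_mono) linarith
    moreover have "(\<Sum>\<alpha>\<in>E. \<Sum>x\<in>X. \<bar>soft_val p \<alpha> x - soft_val r \<alpha> x\<bar>)
      \<le> (\<Sum>\<alpha>\<in>E. \<Sum>x\<in>X. \<bar>soft_val p \<alpha> x - soft_val q \<alpha> x\<bar>)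
        + (\<Sum>\<alpha>\<in>E. \<Sum>x\<in>X. \<bar>soft_val q \<alpha> x - soft_val r \<alpha> x\<bar>)"
      unfolding sum.distrib[symmetric] by (intro sum_mono) linarith
    ultimately show ?thesis
      using that by (simp add: eq)
  qed
  moreover have "d_m X p p = 0" if "p \<in> soft_sets X E" for p
    using that by (simp add: eq)
  moreover have "p = q"
    if pq: "p \<in> soft_sets X E" "q \<in> soft_sets X E" and "d_m X p q = 0" for p q
  proof (rule soft_set_eqI[OF pq])
    have "(\<Sum>\<alpha>\<in>E. \<bar>of_bool (\<alpha> \<in> snd p) - of_bool (\<alpha> \<in> snd q)\<bar> :: real) = 0
      \<and> (\<Sum>\<alpha>\<in>E. \<Sum>x\<in>X. \<bar>soft_val p \<alpha> x - soft_val q \<alpha> x\<bar>) = 0"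
      using that by (subst add_nonneg_eq_0_iff[symmetric]) (auto simp: eq intro!: sum_nonneg)
    \<comment> \<open>Finiteness of \<open>E\<close> and \<open>X\<close> matters here: a vanishing
      finite sum of nonnegative terms has only zero terms, whereas a sum over an infinite set is 0
      by default.\<close>
    then have params: "\<forall>\<alpha>\<in>E. of_bool (\<alpha> \<in> snd p) = (of_bool (\<alpha> \<in> snd q) :: real)"
      and vals: "\<forall>\<alpha>\<in>E. \<forall>x\<in>X. soft_val p \<alpha> x = soft_val q \<alpha> x"
      using assms by (simp_all add: sum_nonneg_eq_0_iff sum_nonneg)
    \<comment> \<open>\<open>params\<close> compares memberships only within \<open>E\<close>, so
      both domains must lie in \<open>E\<close>.\<close>
    have "snd p \<subseteq> E" "snd q \<subseteq> E"
      using pq by (auto simp: soft_sets_def)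
    with params show "snd p = snd q" by (auto simp: of_bool_eq_iff)
    show "soft_val p \<alpha> x = soft_val q \<alpha> x" if "\<alpha> \<in> E" "x \<in> X" for \<alpha> x
      using vals that by blast
  qed
  ultimately show ?thesis
    unfolding metric_on_def by blast
qed

end
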